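(* Let $G$ be a graph and let $\mathcal T$ be the collection of PSD forcing trees (the forcing tree cover) for some PSD forcing set of $G$ of size $k$ (with respect to some relaxed chronology of PSD forces). For any $v\in V(G)$, there exist a PSD forcing set $B$ of $G$ of size $k$ containing $v$ and a relaxed chronology of PSD forces for $B$ on $G$ whose collection of forcing trees is $\mathcal T$.
   Context: All graphs are finite, simple and undirected. Each vertex is blue or white. PSD rule: if $B$ is the current set of blue vertices, $C$ is a component of $G-B$, and $u\in B$ satisfies $N_G(u)\cap V(C)=\{v\}$, then $u$ can force $v$ to become blue ($u\to v$). $B$ is a PSD forcing set if, starting with exactly $B$ blue, repeated forcing turns all vertices blue. $S_+(G,B)$ is the set of PSD forces $v\to u$ valid when exactly $B$ is blue. Relaxed chronology of PSD forces for a PSD forcing set $B$ on $G$: an ordered family $\mathcal F=\{F^{(k)}\}_{k=1}^K$ of sets of forces ($F^{(k)}=\emptyset$ allowed) such that, with $E^{[0]}=E^{(0)}=B$, $E^{(k)}=\{u: v\to u\in F^{(k)}\text{ for some }v\}$, $E^{[k]}=\bigcup_{j=0}^kE^{(j)}$: (1) $F^{(k)}\subseteq S_+(G,E^{[k-1]})$ for all $k$; (2) $v_1\to u,v_2\to u\in F^{(k)}$ implies $v_1=v_2$; (3) $E^{[K]}=V(G)$. Forcing trees: for $b\in B$ let $V_b$ be the set of vertices $w$ for which there is a (possibly empty) sequence of forces $b=v_1\to v_2\to\dots\to v_\ell=w$ in $\bigcup_kF^{(k)}$; the forcing tree is $T_b=G[V_b]$, and the forcing tree cover is $\{T_b:b\in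 B\}$. *)

theory Defs
  imports "Graph_Theory.Digraph_Component"
begin

text \<open>
  A finite simple undirected graph is a finite symmetric digraph without loops and parallel
  arcs (locale \<^locale>\<open>graph\<close>); its strongly connected components are then exactly its connected
  components. A force \<open>u \<rightarrow> v\<close> is the pair \<open>(u, v)\<close>.
\<close>

definition psd_forces :: "('a, 'b) pre_digraph \<Rightarrow> 'a set \<Rightarrow> ('a \<times> 'a) set" where
  "psd_forces G B =
    {(u, v). u \<in> B \<and>
      (\<exists>C \<in> pre_digraph.sccs (G \<restriction> (verts G - B)). {w. u \<rightarrow>\<^bsub>G\<^esub> w} \<inter> verts C = {v})}"

definition psd_step :: "('a, 'b) pre_digraph \<Rightarrow> 'a set \<Rightarrow> 'a set \<Rightarrow> bool" where
  "psd_step G B B' \<longleftrightarrow> (\<exists>(u, v) \<in> psd_forces G B. B' = insert v B)"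

definition psd_forcing_set :: "('a, 'b) pre_digraph \<Rightarrow> 'a set \<Rightarrow> bool" where
  "psd_forcing_set G B \<longleftrightarrow> B \<subseteq> verts G \<and> (psd_step G)\<^sup>*\<^sup>* B (verts G)"

text \<open>
  The family \<open>F\<^sup>(\<^sup>1\<^sup>), \<dots>, F\<^sup>(\<^sup>K\<^sup>)\<close> is a list of length \<open>K\<close>. As list positions start at 0,
  \<open>F\<^sup>(\<^sup>j\<^sup>+\<^sup>1\<^sup>)\<close> is \<open>F ! j\<close>, and \<open>blue_after B F k\<close> is \<open>E\<^sup>[\<^sup>k\<^sup>]\<close>.
\<close>

definition blue_after :: "'a set \<Rightarrow> ('a \<times> 'a) set list \<Rightarrow> nat \<Rightarrow> 'a set" where
  "blue_after B F k = B \<union> (\<Union>j<k. Range (F ! j))"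

definition relaxed_chronology ::
  "('a, 'b) pre_digraph \<Rightarrow> 'a set \<Rightarrow> ('a \<times> 'a) set list \<Rightarrow> bool" where
  "relaxed_chronology G B F \<longleftrightarrow>
    (\<forall>k < length F. F ! k \<subseteq> psd_forces G (blue_after B F k)) \<and>
    (\<forall>k < length F. \<forall>v1 v2 u. (v1, u) \<in> F ! k \<and> (v2, u) \<in> F ! k \<longrightarrow> v1 = v2) \<and>
    blue_after B F (length F) = verts G"

definition forcing_tree ::
  "('a, 'b) pre_digraph \<Rightarrow> ('a \<times> 'a) set list \<Rightarrow> 'a \<Rightarrow> ('a, 'b) pre_digraph" where
  "forcing_tree G F b = G \<restriction> {w. (b, w) \<in> (\<Union>(set F))\<^sup>*}"

definition forcing_tree_cover ::
  "('a, 'b) pre_digraph \<Rightarrow> 'a set \<Rightarrow> ('a \<times> 'a) set list \<Rightarrow> ('a, 'b) pre_digraph set" where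
  "forcing_tree_cover G B F = forcing_tree G F ` B"

end

theory Submission
  imports Defs
begin

text \<open>
  Let \<open>b \<rightarrow> w\<close> be the first force whose target lies in the component \<open>C\<close> of \<open>v\<close> in \<open>G - B\<close>. Up to that
  moment nothing in \<open>C\<close> has changed, so \<open>b \<in> B\<close> and the force is already valid for \<open>B\<close>. Let
  \<open>B'\<close> be \<open>B\<close> with \<open>b\<close> replaced by \<open>w\<close>. Then \<open>w \<rightarrow> b\<close> is valid for \<open>B'\<close>, and after this single force
  the set \<open>B \<union> {w}\<close> is blue, so the old chronology without \<open>b \<rightarrow> w\<close> finishes the job. The effect on
  the forcing forest is that the edge \<open>b \<rightarrow> w\<close> is reversed, which keeps the vertex sets of all trees.
  Since the component of \<open>v\<close> in \<open>G - B'\<close> is contained in \<open>C - {w}\<close>, iterating reaches a set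
  containing \<open>v\<close>.
\<close>

section \<open>White components\<close>

text \<open>The vertex set of the component of v in G - B. It is empty when v is blue, since
  reachability is restricted to vertices of the induced subgraph.\<close>

definition white_comp :: "('a, 'b) pre_digraph \<Rightarrow> 'a set \<Rightarrow> 'a \<Rightarrow> 'a set" where
  "white_comp G B v = {w. v \<rightarrow>\<^sup>*\<^bsub>G \<restriction> (verts G - B)\<^esub> w}"

context sym_digraph
begin

lemma sym_digraph_white: "sym_digraph (G \<restriction> (verts G - B))"
proof -
  interpret H: wf_digraph "G \<restriction> (verts G - B)" by blast
  show ?thesis
    by unfold_locales (rule induced_graph_imp_symmetric[OF sym_arcs induced_induce], blast)
qed

lemma white_comp_subset_white: "white_comp G B v \<subseteq> verts G - B"
proof -
  interpret H: sym_digraph "G \<restriction> (verts G - B)" by (rule sym_digraph_white)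
  show ?thesis
    unfolding white_comp_def using H.reachable_in_verts(2) by auto
qed

lemma in_white_comp_self: "v \<in> verts G - B \<Longrightarrow> v \<in> white_comp G B v"
proof -
  interpret H: sym_digraph "G \<restriction> (verts G - B)" by (rule sym_digraph_white)
  show "v \<in> verts G - B \<Longrightarrow> v \<in> white_comp G B v"
    unfolding white_comp_def by simp
qed

lemma white_comp_eq:
  assumes "w \<in> white_comp G B v"
  shows "white_comp G B w = white_comp G B v"
proof -
  interpret H: sym_digraph "G \<restriction> (verts G - B)" by (rule sym_digraph_white)
  have vw: "v \<rightarrow>\<^sup>*\<^bsub>G \<restriction> (verts G - B)\<^esub> w" using assms by (simp add: white_comp_def)
  moreover have "w \<rightarrow>\<^sup>*\<^bsub>G \<restriction> (verts G - B)\<^esub> v"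
    using symmetric_reachable[OF H.sym_arcs vw] .
  ultimately show ?thesis
    unfolding white_comp_def using H.reachable_trans by blast
qed

lemma dominates_whiteI:
  assumes "x \<rightarrow>\<^bsub>G\<^esub> y" "x \<notin> B" "y \<notin> B"
  shows "x \<rightarrow>\<^bsub>G \<restriction> (verts G - B)\<^esub> y"
  using assms adj_in_verts[OF assms(1)] by (auto simp: arcs_ends_conv)

lemma white_comp_closed:
  assumes "x \<in> white_comp G B v" "x \<rightarrow>\<^bsub>G\<^esub> y" "y \<notin> B"
  shows "y \<in> white_comp G B v"
proof -
  interpret H: sym_digraph "G \<restriction> (verts G - B)" by (rule sym_digraph_white)
  have "x \<rightarrow>\<^bsub>G \<restriction> (verts G - B)\<^esub> y"
    using assms white_comp_subset_white by (blast intro: dominates_whiteI)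
  then show ?thesis
    using assms(1) H.reachable_adj_trans unfolding white_comp_def by blast
qed

text \<open>Induction along a white walk from v. This is the tool for comparing components with
  respect to different blue sets: only closure under single white steps has to be checked.\<close>

lemma white_comp_subsetI:
  assumes "v \<in> S" "\<And>x y. x \<in> S \<Longrightarrow> x \<rightarrow>\<^bsub>G\<^esub> y \<Longrightarrow> y \<notin> B \<Longrightarrow> y \<in> S"
  shows "white_comp G B v \<subseteq> S"
proof
  interpret H: sym_digraph "G \<restriction> (verts G - B)" by (rule sym_digraph_white)
  fix w assume "w \<in> white_comp G B v"
  then have "v \<rightarrow>\<^sup>*\<^bsub>G \<restriction> (verts G - B)\<^esub> w" by (simp add: white_comp_def)
  then show "w \<in> S"
  proof (induction rule: H.reachable_induct)
    case base
    then show ?case using assms(1) by simp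
  next
    case (step x y)
    have "x \<rightarrow>\<^bsub>G\<^esub> y" "y \<notin> B"
      using step(2) H.adj_in_verts(2)[OF step(2)] by (auto dest: dominates_induce_subgraphD)
    then show ?case using assms(2) step by blast
  qed
qed

lemma white_comp_antimono:
  assumes "B \<subseteq> B'" "v \<in> verts G - B"
  shows "white_comp G B' v \<subseteq> white_comp G B v"
  using assms
  by (intro white_comp_subsetI) (auto intro: in_white_comp_self white_comp_closed)

text \<open>A component witnessing the force contains v, so it is the component of v; this removes
  the quantifier over components.\<close>

lemma psd_forces_iff:
  "(u, v) \<in> psd_forces G B \<longleftrightarrow>
    u \<in> B \<and> v \<in> verts G - B \<and> {w. u \<rightarrow>\<^bsub>G\<^esub> w} \<inter> white_comp G B v = {v}"
proof -
  interpret H: sym_digraph "G \<restriction> (verts G - B)" by (rule sym_digraph_white)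
  have scc_of: "H.scc_of x = white_comp G B x" for x
    unfolding H.scc_of_def white_comp_def using symmetric_reachable[OF H.sym_arcs] by blast
  have sccs: "verts ` H.sccs = white_comp G B ` (verts G - B)"
    using H.sccs_verts_conv H.sccs_verts_conv_scc_of by (simp add: scc_of)
  have "(u, v) \<in> psd_forces G B \<longleftrightarrow>
      u \<in> B \<and> (\<exists>C \<in> verts ` H.sccs. {w. u \<rightarrow>\<^bsub>G\<^esub> w} \<inter> C = {v})"
    by (auto simp: psd_forces_def)
  also have "\<dots> \<longleftrightarrow> u \<in> B \<and> (\<exists>x \<in> verts G - B. {w. u \<rightarrow>\<^bsub>G\<^esub> w} \<inter> white_comp G B x = {v})"
    unfolding sccs by blast
  also have "\<dots> \<longleftrightarrow> u \<in> B \<and> v \<in> verts G - B \<and> {w. u \<rightarrow>\<^bsub>G\<^esub> w} \<inter> white_comp G B v = {v}"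
    using white_comp_eq white_comp_subset_white by blast
  finally show ?thesis .
qed

text \<open>More blue vertices can only shrink the component of v; as long as v stays white, it
  remains the only neighbour of u there.\<close>

lemma psd_forces_mono:
  assumes "(u, v) \<in> psd_forces G B" "B \<subseteq> B'" "v \<notin> B'"
  shows "(u, v) \<in> psd_forces G B'"
  using assms white_comp_antimono[of B B' v] in_white_comp_self[of v B']
  unfolding psd_forces_iff by blast

section \<open>Relaxed chronologies yield forcing sets\<close>

text \<open>Simultaneous forces can be performed one after another: by
  \<open>psd_forces_mono\<close> each stays valid after the others.\<close>

lemma psd_steps_Range:
  assumes "finite S" "S \<subseteq> Range (psd_forces G B)"
  shows "(psd_step G)\<^sup>*\<^sup>* B (B \<union> S)"
  using assms
proof (induction S rule: finite_induct)
  case empty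
  then show ?case by simp
next
  case (insert v S)
  then have IH: "(psd_step G)\<^sup>*\<^sup>* B (B \<union> S)" by blast
  show ?case
  proof (cases "v \<in> B")
    case True
    then show ?thesis using IH by (simp add: insert_absorb)
  next
    case False
    obtain u where "(u, v) \<in> psd_forces G B" using insert.prems by blast
    then have "(u, v) \<in> psd_forces G (B \<union> S)"
      using psd_forces_mono False insert.hyps by blast
    then have "psd_step G (B \<union> S) (B \<union> insert v S)"
      unfolding psd_step_def by auto
    with IH show ?thesis by (rule rtranclp.rtrancl_into_rtrancl)
  qed
qed

end

lemma blue_after_0 [simp]: "blue_after B F 0 = B"
  by (simp add: blue_after_def)

lemma blue_after_Suc: "blue_after B F (Suc k) = blue_after B F k \<union> Range (F ! k)"
  unfolding blue_after_def lessThan_Suc by blast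

lemma blue_after_mono: "j \<le> k \<Longrightarrow> blue_after B F j \<subseteq> blue_after B F k"
  by (force simp: blue_after_def)

lemma blue_after_Cons: "blue_after B (X # F) (Suc k) = blue_after (B \<union> Range X) F k"
  unfolding blue_after_def
  by (auto simp: lessThan_Suc_eq_insert_0)

context pseudo_graph
begin

lemma relaxed_chronology_imp_psd_forcing_set:
  assumes "relaxed_chronology G B F"
  shows "psd_forcing_set G B"
proof -
  have V: "blue_after B F (length F) = verts G"
    and valid: "\<And>k. k < length F \<Longrightarrow> F ! k \<subseteq> psd_forces G (blue_after B F k)"
    using assms by (auto simp: relaxed_chronology_def)
  have "(psd_step G)\<^sup>*\<^sup>* B (blue_after B F k)" if "k \<le> length F" for k
    using that
  proof (induction k)
    case 0
    then show ?case by simp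
  next
    case (Suc k)
    have "Range (F ! k) \<subseteq> verts G"
      using blue_after_mono[OF Suc.prems, of B F] V by (auto simp: blue_after_Suc)
    then have "finite (Range (F ! k))"
      using finite_verts by (rule finite_subset)
    moreover have "Range (F ! k) \<subseteq> Range (psd_forces G (blue_after B F k))"
      using valid[of k] Suc.prems by auto
    ultimately have "(psd_step G)\<^sup>*\<^sup>* (blue_after B F k) (blue_after B F (Suc k))"
      unfolding blue_after_Suc by (rule psd_steps_Range)
    with Suc show ?case by (meson Suc_leD rtranclp_trans)
  qed
  moreover have "B \<subseteq> verts G"
    using blue_after_mono[of 0 "length F" B F] V by simp
  ultimately show ?thesis
    using V by (metis order_refl psd_forcing_set_def)
qed

end

section \<open>Reversing one edge of the forcing forest\<close>

text \<open>The new root w replaces b. The new edge lets w reach b, and the deleted edge led only to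
  w, where the walk now starts.\<close>

lemma rtrancl_flip_at_source:
  fixes R :: "('a \<times> 'a) set"
  assumes "(b, w) \<in> R"
  defines "R' \<equiv> insert (w, b) (R - {(b, w)})"
  shows "R'\<^sup>* `` {w} = R\<^sup>* `` {b}"
proof (intro equalityI subsetI)
  fix z assume "z \<in> R'\<^sup>* `` {w}"
  then have "(w, z) \<in> R'\<^sup>*" by simp
  then have "(b, z) \<in> R\<^sup>*"
  proof (induction rule: rtrancl_induct)
    case base
    then show ?case using assms(1) by auto
  next
    case (step x y)
    then show ?case unfolding R'_def by (auto intro: rtrancl_into_rtrancl)
  qed
  then show "z \<in> R\<^sup>* `` {b}" by simp
next
  fix z assume "z \<in> R\<^sup>* `` {b}"
  then have "(b, z) \<in> R\<^sup>*" by simp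
  then have "(w, z) \<in> R'\<^sup>*"
  proof (induction rule: rtrancl_induct)
    case base
    then show ?case unfolding R'_def by auto
  next
    case (step x y)
    then show ?case
      by (cases "(x, y) = (b, w)") (auto simp: R'_def intro: rtrancl_into_rtrancl)
  qed
  then show "z \<in> R'\<^sup>* `` {w}" by simp
qed

text \<open>Nothing enters b and only b enters w, so a walk in \<open>R\<close> from c meets neither
  vertex and cannot use the edges in which \<open>R\<close> and \<open>R'\<close> differ.\<close>

lemma rtrancl_flip_elsewhere:
  fixes R :: "('a \<times> 'a) set"
  assumes "\<And>x. (x, w) \<in> R \<Longrightarrow> x = b" "b \<notin> Range R" "c \<noteq> b" "c \<noteq> w"
  defines "R' \<equiv> insert (w, b) (R - {(b, w)})"
  shows "R'\<^sup>* `` {c} = R\<^sup>* `` {c}"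
proof (intro equalityI subsetI)
  have not_b: "(c, b) \<notin> R\<^sup>*"
    using assms(2,3) by (metis RangeI rtranclE)
  then have not_w: "(c, w) \<notin> R\<^sup>*"
    using assms(1,4) by (metis rtranclE)
  fix z
  show "z \<in> R\<^sup>* `` {c}" if "z \<in> R'\<^sup>* `` {c}"
  proof -
    have "(c, z) \<in> R'\<^sup>*" using that by simp
    then have "(c, z) \<in> R\<^sup>*"
    proof (induction rule: rtrancl_induct)
      case (step x y)
      then show ?case using not_w unfolding R'_def by (auto intro: rtrancl_into_rtrancl)
    qed auto
    then show ?thesis by simp
  qed
  show "z \<in> R'\<^sup>* `` {c}" if "z \<in> R\<^sup>* `` {c}"
  proof -
    have "(c, z) \<in> R\<^sup>*" using that by simp
    then have "(c, z) \<in> R'\<^sup>*"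
    proof (induction rule: rtrancl_induct)
      case (step x y)
      then have "(x, y) \<in> R'" using not_b unfolding R'_def by auto
      then show ?case using step by (auto intro: rtrancl_into_rtrancl)
    qed auto
    then show ?thesis by simp
  qed
qed

section \<open>Moving a root along its first force\<close>

context sym_digraph
begin

text \<open>Let C be the component of w for \<open>B\<close>. As w is the only neighbour of b in C,
  whitening b does not connect it to C - {w}; this gives the second claim. For the first, another
  neighbour z of w in the new component of b would lie in C - {w}, whose components by the second
  claim avoid b.\<close>

lemma psd_force_reverse:
  assumes "(b, w) \<in> psd_forces G B" "B \<subseteq> verts G"
  defines "B' \<equiv> insert w (B - {b})"
  shows "(w, b) \<in> psd_forces G B'"
    and "x \<in> white_comp G B w \<Longrightarrow> x \<noteq> w \<Longrightarrow> white_comp G B' x \<subseteq> white_comp G B w - {w}"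
proof -
  have b: "b \<in> B" and w: "w \<in> verts G - B"
    and N: "{x. b \<rightarrow>\<^bsub>G\<^esub> x} \<inter> white_comp G B w = {w}"
    using assms(1) unfolding psd_forces_iff by auto
  show sub: "white_comp G B' x \<subseteq> white_comp G B w - {w}"
    if x: "x \<in> white_comp G B w" "x \<noteq> w" for x
  proof (rule white_comp_subsetI)
    show "x \<in> white_comp G B w - {w}" using x by blast
  next
    fix y z assume y: "y \<in> white_comp G B w - {w}" and yz: "y \<rightarrow>\<^bsub>G\<^esub> z" and z: "z \<notin> B'"
    have "z \<noteq> b" using N y graph_symmetric[OF yz] by blast
    then show "z \<in> white_comp G B w - {w}"
      using white_comp_closed[of y B w z] y yz z unfolding B'_def by blast
  qed
  have bB': "b \<in> verts G - B'" using b w assms(2) unfolding B'_def by blast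
  have "z = b" if wz: "w \<rightarrow>\<^bsub>G\<^esub> z" and z: "z \<in> white_comp G B' b" for z
  proof (rule ccontr)
    assume "z \<noteq> b"
    have zB': "z \<notin> B'" using z white_comp_subset_white by blast
    then have "z \<notin> B" using \<open>z \<noteq> b\<close> unfolding B'_def by blast
    then have "z \<in> white_comp G B w"
      using white_comp_closed[OF in_white_comp_self[OF w] wz] by blast
    moreover have "z \<noteq> w" using zB' unfolding B'_def by blast
    ultimately have "white_comp G B' z \<subseteq> white_comp G B w" using sub by blast
    moreover have "b \<in> white_comp G B' z"
      using white_comp_eq[OF z] in_white_comp_self[OF bB'] by blast
    ultimately show False using b white_comp_subset_white by blast
  qed
  moreover have "w \<rightarrow>\<^bsub>G\<^esub> b" using N by (blast intro: graph_symmetric)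
  ultimately show "(w, b) \<in> psd_forces G B'"
    using bB' in_white_comp_self[OF bB'] unfolding psd_forces_iff B'_def by blast
qed

lemma first_force_into_white_comp:
  assumes chron: "relaxed_chronology G B F" and v: "v \<in> verts G - B"
  obtains k b w where "k < length F" "(b, w) \<in> F ! k" "w \<in> white_comp G B v"
    "(b, w) \<in> psd_forces G B"
proof -
  let ?C = "white_comp G B v"
  let ?P = "\<lambda>k. k < length F \<and> Range (F ! k) \<inter> ?C \<noteq> {}"
  \<comment> \<open>The vertex v is white at the start and blue at the end, hence the target of some
    force.\<close>
  have ex: "\<exists>k. ?P k"
    using chron v in_white_comp_self[OF v]
    unfolding relaxed_chronology_def blue_after_def by blast
  define k where "k = (LEAST k. ?P k)"
  have k: "?P k" unfolding k_def using ex by (rule LeastI_ex)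
  have before: "Range (F ! j) \<inter> ?C = {}" if "j < k" for j
    using not_less_Least[of j ?P] that k unfolding k_def[symmetric] by auto
  let ?E = "blue_after B F k"
  obtain b w where bw: "(b, w) \<in> F ! k" "w \<in> ?C" using k by blast
  have force: "(b, w) \<in> psd_forces G ?E"
    using chron k bw(1) unfolding relaxed_chronology_def by blast
  have E: "?E \<inter> ?C = {}"
    using before white_comp_subset_white unfolding blue_after_def by blast
  have comp: "white_comp G B w = ?C" using bw(2) by (rule white_comp_eq)
  \<comment> \<open>Validity must pass from \<open>?E\<close> back to the smaller set
    \<open>B\<close>, against the direction of \<open>psd_forces_mono\<close>. This works because
    \<open>?E\<close> misses \<open>?C\<close>, so the component has not shrunk yet.\<close>
  have "white_comp G B w \<subseteq> white_comp G ?E w \<inter> ?C"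
  proof (rule white_comp_subsetI)
    show "w \<in> white_comp G ?E w \<inter> ?C"
      using force bw(2) in_white_comp_self unfolding psd_forces_iff by blast
  next
    fix x y assume "x \<in> white_comp G ?E w \<inter> ?C" "x \<rightarrow>\<^bsub>G\<^esub> y" "y \<notin> B"
    then show "y \<in> white_comp G ?E w \<inter> ?C"
      using E white_comp_closed[of x B v y] white_comp_closed[of x ?E w y] by blast
  qed
  moreover have wB: "w \<in> verts G - B" using bw(2) white_comp_subset_white by blast
  \<comment> \<open>Otherwise b, as a neighbour of w, would lie in \<open>?C\<close>, yet b is
    already blue when it forces.\<close>
  moreover have "b \<in> B"
  proof (rule ccontr)
    assume "b \<notin> B"
    moreover have "w \<rightarrow>\<^bsub>G\<^esub> b" using force unfolding psd_forces_iff by (blast intro: graph_symmetric)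
    ultimately have "b \<in> ?C" using white_comp_closed bw(2) by blast
    then show False using E force unfolding psd_forces_iff by blast
  qed
  ultimately have "(b, w) \<in> psd_forces G B"
    using force in_white_comp_self[OF wB] unfolding psd_forces_iff by blast
  then show ?thesis using that k bw by blast
qed

lemma relaxed_chronology_target_white:
  assumes "relaxed_chronology G B F" "k < length F" "(x, y) \<in> F ! k"
  shows "y \<notin> blue_after B F k"
  using assms unfolding relaxed_chronology_def by (force simp: psd_forces_iff)

text \<open>The target of an earlier force is blue later on, so two forces into y share a time step,
  where sources are unique by definition.\<close>

lemma relaxed_chronology_unique_source:
  assumes chron: "relaxed_chronology G B F"
    and "(x, y) \<in> \<Union>(set F)" "(x', y) \<in> \<Union>(set F)"
  shows "x = x'"
proof -
  obtain i j where ij: "i < length F" "(x, y) \<in> F ! i" "j < length F" "(x', y) \<in> F ! j"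
    using assms(2,3) by (auto simp: in_set_conv_nth)
  have "\<not> i < j" "\<not> j < i"
    using relaxed_chronology_target_white[OF chron] ij unfolding blue_after_def by blast+
  then have "i = j" by simp
  then show ?thesis using chron ij unfolding relaxed_chronology_def by blast
qed

text \<open>Deleting the old force may leave an empty time step, which a relaxed chronology permits.
  The list thus keeps its alignment with \<open>F\<close>, shifted by one position for the new first
  force.\<close>

lemma relaxed_chronology_reverse_force:
  assumes chron: "relaxed_chronology G B F" and B: "B \<subseteq> verts G"
    and bw: "(b, w) \<in> \<Union>(set F)" "(b, w) \<in> psd_forces G B"
  defines "B' \<equiv> insert w (B - {b})"
    and "F' \<equiv> {(w, b)} # map (\<lambda>X. X - {(b, w)}) F"
  shows "relaxed_chronology G B' F'"
    and "forcing_tree_cover G B' F' = forcing_tree_cover G B F"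
proof -
  let ?R = "\<Union>(set F)" and ?R' = "\<Union>(set F')"
  have b: "b \<in> B" and w: "w \<notin> B" "w \<in> verts G" using bw(2) unfolding psd_forces_iff by auto
  have blue_Suc: "blue_after B' F' (Suc k) = insert w (blue_after B F k)" if "k \<le> length F" for k
  proof -
    \<comment> \<open>Deleting \<open>(b, w)\<close> can lose no target but w, which is already blue
      here.\<close>
    have "blue_after (insert w B) (map (\<lambda>X. X - {(b, w)}) F) k = insert w (blue_after B F k)"
      using that by (fastforce simp: blue_after_def)
    moreover have "B' \<union> Range {(w, b)} = insert w B" using b unfolding B'_def by blast
    ultimately show ?thesis unfolding F'_def blue_after_Cons by simp
  qed
  have uniq: "x = b" if "(x, w) \<in> ?R" for x
    using relaxed_chronology_unique_source[OF chron that bw(1)] .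
  show "relaxed_chronology G B' F'"
    unfolding relaxed_chronology_def
  proof (intro conjI allI impI)
    fix k assume k: "k < length F'"
    show "F' ! k \<subseteq> psd_forces G (blue_after B' F' k)"
    proof (cases k)
      case 0
      then show ?thesis
        using psd_force_reverse(1)[OF bw(2) B] by (simp add: F'_def B'_def)
    next
      case (Suc j)
      then have j: "j < length F" using k by (simp add: F'_def)
      show ?thesis
      proof (rule subrelI)
        fix x y assume "(x, y) \<in> F' ! k"
        then have xy: "(x, y) \<in> F ! j" "(x, y) \<noteq> (b, w)" using Suc j by (auto simp: F'_def)
        have "(x, y) \<in> ?R" using xy(1) j nth_mem by blast
        \<comment> \<open>The target must still be white although w turns blue early; b was the only
          source of forces into w.\<close>
        then have "y \<noteq> w" using uniq xy(2) by blast
        moreover have "y \<notin> blue_after B F j"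
          using relaxed_chronology_target_white[OF chron j xy(1)] .
        moreover have "(x, y) \<in> psd_forces G (blue_after B F j)"
          using chron j xy(1) unfolding relaxed_chronology_def by blast
        ultimately show "(x, y) \<in> psd_forces G (blue_after B' F' k)"
          using j unfolding Suc by (auto simp: blue_Suc intro: psd_forces_mono)
      qed
    qed
  next
    fix k x x' y
    assume k: "k < length F'" and xx': "(x, y) \<in> F' ! k \<and> (x', y) \<in> F' ! k"
    show "x = x'"
    proof (cases k)
      case 0
      then show ?thesis using xx' by (simp add: F'_def)
    next
      case (Suc j)
      then have "j < length F" "(x, y) \<in> F ! j" "(x', y) \<in> F ! j"
        using k xx' by (auto simp: F'_def)
      then show ?thesis using chron unfolding relaxed_chronology_def by blast
    qed
  next
    have "blue_after B' F' (length F') = insert w (blue_after B F (length F))"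
      using blue_Suc[of "length F"] by (simp add: F'_def)
    then show "blue_after B' F' (length F') = verts G"
      using chron w unfolding relaxed_chronology_def by auto
  qed
  have R': "?R' = insert (w, b) (?R - {(b, w)})" unfolding F'_def by auto
  have not_forced: "y \<notin> B" if xy: "(x, y) \<in> ?R" for x y
  proof -
    obtain k where "k < length F" "(x, y) \<in> F ! k" using xy by (auto simp: in_set_conv_nth)
    then show ?thesis
      using relaxed_chronology_target_white[OF chron] unfolding blue_after_def by blast
  qed
  have tree: "forcing_tree G F'' c = G \<restriction> ((\<Union>(set F''))\<^sup>* `` {c})" for F'' c
    unfolding forcing_tree_def by (rule arg_cong[where f = "\<lambda>S. G \<restriction> S"]) auto
  have "forcing_tree G F' w = forcing_tree G F b"
    unfolding tree R' using rtrancl_flip_at_source[OF bw(1)] by simp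
  moreover have "forcing_tree G F' c = forcing_tree G F c" if "c \<in> B - {b}" for c
  proof -
    have "b \<notin> Range ?R" "c \<noteq> b" "c \<noteq> w" using b w that not_forced by blast+
    then show ?thesis unfolding tree R' using rtrancl_flip_elsewhere[where R = ?R, OF uniq] by simp
  qed
  \<comment> \<open>The trees are matched root by root: w with b, and every other root with
    itself.\<close>
  ultimately have "forcing_tree G F' ` B' = forcing_tree G F ` insert b (B - {b})"
    unfolding B'_def image_insert by (metis (no_types, lifting) image_cong)
  then show "forcing_tree_cover G B' F' = forcing_tree_cover G B F"
    unfolding forcing_tree_cover_def using b by (simp add: insert_absorb)
qed

end

text \<open>Induction on the size of the white component of v: each reversal either makes v blue or
  removes at least w from that component.\<close>

lemma (in pseudo_graph) relaxed_chronology_reroot: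
  assumes "relaxed_chronology G B F" "B \<subseteq> verts G" "v \<in> verts G"
  shows "\<exists>B' F'. relaxed_chronology G B' F' \<and> card B' = card B \<and> v \<in> B' \<and>
           forcing_tree_cover G B' F' = forcing_tree_cover G B F"
  using assms
proof (induction "card (white_comp G B v)" arbitrary: B F rule: less_induct)
  case less
  show ?case
  proof (cases "v \<in> B")
    case True
    then show ?thesis using less.prems by blast
  next
    case False
    then have v: "v \<in> verts G - B" using less.prems by blast
    obtain k b w where k: "k < length F" "(b, w) \<in> F ! k"
      and w: "w \<in> white_comp G B v" and force: "(b, w) \<in> psd_forces G B"
      using first_force_into_white_comp[OF less.prems(1) v] .
    define B' where "B' = insert w (B - {b})"
    define F' where "F' = {(w, b)} # map (\<lambda>X. X - {(b, w)}) F"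
    have "(b, w) \<in> \<Union>(set F)" using k by auto
    note rev = relaxed_chronology_reverse_force[OF less.prems(1,2) this force,
        folded B'_def F'_def]
    have bB: "b \<in> B" and wB: "w \<notin> B" "w \<in> verts G"
      using force unfolding psd_forces_iff by auto
    have B': "B' \<subseteq> verts G" using wB less.prems(2) unfolding B'_def by blast
    have "finite B" using less.prems(2) finite_verts by (rule finite_subset)
    then have card: "card B' = card B"
      unfolding B'_def using bB wB by (metis card.remove card_insert_disjoint finite_Diff Diff_iff)
    show ?thesis
    proof (cases "v = w")
      case True
      then have "v \<in> B'" unfolding B'_def by blast
      then show ?thesis using rev card by blast
    next
      case False
      have comp: "white_comp G B w = white_comp G B v" using w by (rule white_comp_eq)
      have "v \<in> white_comp G B w" using comp in_white_comp_self[OF v] by simp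
      then have "white_comp G B' v \<subseteq> white_comp G B v - {w}"
        using psd_force_reverse(2)[OF force less.prems(2), of v] False comp
        unfolding B'_def by simp
      moreover have "finite (white_comp G B v)"
        using white_comp_subset_white finite_verts by (meson finite_Diff finite_subset)
      ultimately have "card (white_comp G B' v) < card (white_comp G B v)"
        using w by (intro psubset_card_mono) auto
      from less.hyps[OF this rev(1) B' less.prems(3)] show ?thesis
        using rev(2) card by simp
    qed
  qed
qed

theorem corollary5p12:
  fixes G :: "('a, 'b) pre_digraph"
    and B :: "'a set"
    and F :: "('a \<times> 'a) set list"
    and \<T> :: "('a, 'b) pre_digraph set"
    and k :: nat
    and v :: 'a
  assumes "graph G"
    and "psd_forcing_set G B"
    and "card B = k"
    and "relaxed_chronology G B F"
    and "\<T> = forcing_tree_cover G B F"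
    and "v \<in> verts G"
  shows "\<exists>B' F'. psd_forcing_set G B' \<and> card B' = k \<and> v \<in> B' \<and>
           relaxed_chronology G B' F' \<and> forcing_tree_cover G B' F' = \<T>"


proof -
  interpret graph G by fact
  have "B \<subseteq> verts G" using assms(2) by (simp add: psd_forcing_set_def)
  from relaxed_chronology_reroot[OF assms(4) this assms(6)] show ?thesis
    using assms(3,5) relaxed_chronology_imp_psd_forcing_set by metis
qed

end
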